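(* Let $n\ge 2$, let $\Omega_1,\ldots,\Omega_n$ be closed subsets of a Banach space $X$, $\bar x\in\bigcap_{i=1}^n\Omega_i$, $a_i\in X$ $(i=1,\ldots,n-1)$, $\varepsilon>0$ and $\varphi\in\mathcal{C}$. Suppose that $$\bigcap_{i=1}^{n-1}(\Omega_i-a_i)\cap\Omega_n=\emptyset$$ and $$\varphi\Big(\max_{1\le i\le n-1}\|a_i\|\Big)<\varphi\big(d(\Omega_1-a_1,\ldots,\Omega_{n-1}-a_{n-1},\Omega_n)\big)+\varepsilon.$$ Then, for any $\lambda>0$ and $\eta>0$, there exist points $\omega_i\in\Omega_i\cap\mathbb{B}_\lambda(\bar x)$ $(i=1,\ldots,n-1)$ and $\omega_n\in\Omega_n\cap\mathbb{B}_\eta(\bar x)$ such that $$\sup_{\substack{u_i\in\Omega_i\,(i=1,\ldots,n)\\(u_1,\ldots,u_n)\ne(\omega_1,\ldots,\omega_n)}}\frac{\varphi\Big(\max\limits_{1\le i\le n-1}\|\omega_n+a_i-\omega_i\|\Big)-\varphi\Big(\max\limits_{1\le i\le n-1}\|u_n+a_i-u_i\|\Big)}{\|(u_1-\omega_1,\ldots,u_n-\omega_n)\|_{\lambda,\eta}}<\varepsilon,$$ $$0<\max_{1\le i\le n-1}\|\omega_n+a_i-\omega_i\|\le\max_{1\le i\le n-1}\|a_i\|.$$ As a consequence, $$\limsup_{\substack{\Omega_i\ni u_i\to\omega_i\,(i=1,\ldots,n)\\(u_1,\ldots,u_n)\ne(\omega_1,\ldots,\omega_n)}}\frac{\varphi\Big(\max\limits_{1\le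 i\le n-1}\|\omega_n+a_i-\omega_i\|\Big)-\varphi\Big(\max\limits_{1\le i\le n-1}\|u_n+a_i-u_i\|\Big)}{\|(u_1-\omega_1,\ldots,u_n-\omega_n)\|_{\lambda,\eta}}<\varepsilon.$$ Moreover, if $\varphi$ is differentiable at $\max_{1\le i\le n-1}\|\omega_n+a_i-\omega_i\|$, then $$\varphi'\Big(\max_{1\le i\le n-1}\|\omega_n+a_i-\omega_i\|\Big)\cdot\limsup_{\substack{\Omega_i\ni u_i\to\omega_i\,(i=1,\ldots,n)\\(u_1,\ldots,u_n)\ne(\omega_1,\ldots,\omega_n)}}\frac{\max\limits_{1\le i\le n-1}\|\omega_n+a_i-\omega_i\|-\max\limits_{1\le i\le n-1}\|u_n+a_i-u_i\|}{\|(u_1-\omega_1,\ldots,u_n-\omega_n)\|_{\lambda,\eta}}<\varepsilon,$$ with the convention $0\cdot(+\infty)=0$.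
   Context: $\mathbb{B}_\delta(x)$ is the open ball with center $x$ and radius $\delta$. $\mathcal{C}$ is the family of all continuous strictly increasing functions $\varphi:\mathbb{R}_+\to\mathbb{R}_+$ with $\varphi(0)=0$ and $\lim_{t\to+\infty}\varphi(t)=+\infty$. For subsets $\Omega_1,\ldots,\Omega_n$ of $X$, $$d(\Omega_1,\ldots,\Omega_n):=\inf_{u_i\in\Omega_i\,(i=1,\ldots,n)}\ \max_{1\le i\le n-1}\|u_n-u_i\|.$$ For $\lambda,\eta>0$, the norm $\|\cdot\|_{\lambda,\eta}$ on $X^n$ is $$\|(u_1,\ldots,u_n)\|_{\lambda,\eta}:=\max\{\lambda^{-1}\|u_1\|,\ldots,\lambda^{-1}\|u_{n-1}\|,\eta^{-1}\|u_n\|\}.$$ Convention: a supremum (or upper limit) over an empty set of admissible $(u_1,\ldots,u_n)$ is taken to be $0$. *)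

theory Defs
  imports "HOL-Analysis.Analysis"
begin

text \<open>
  An \<open>n\<close>-tuple \<open>(u\<^sub>1, \<dots>, u\<^sub>n)\<close> with \<open>u\<^sub>i \<in> \<Omega>\<^sub>i\<close> is an element of \<open>Pi\<^sub>E {1..n} \<Omega>\<close>.  As such functions
  agree outside \<open>{1..n}\<close>, equality of functions is equality of tuples, and the (product) topology
  on functions induces componentwise convergence \<open>u\<^sub>i \<rightarrow> \<omega>\<^sub>i\<close>.
\<close>

text \<open>Only the restriction of \<open>\<phi>\<close> to \<open>{0..}\<close> matters.\<close>

definition class_C :: "(real \<Rightarrow> real) set" where
  "class_C = {\<phi>. \<phi> \<in> {0..} \<rightarrow> {0..} \<and> continuous_on {0..} \<phi> \<and> strict_mono_on {0..} \<phi>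
     \<and> \<phi> 0 = 0 \<and> filterlim \<phi> at_top at_top}"

text \<open>The infimum is taken in the reals, so this is meaningful only if all \<open>\<Omega>\<^sub>i\<close> are nonempty.\<close>

definition set_dist :: "nat \<Rightarrow> (nat \<Rightarrow> 'a::real_normed_vector set) \<Rightarrow> real" where
  "set_dist n \<Omega> = (INF u\<in>Pi\<^sub>E {1..n} \<Omega>. MAX i\<in>{1..n-1}. norm (u n - u i))"

definition wnorm :: "nat \<Rightarrow> real \<Rightarrow> real \<Rightarrow> (nat \<Rightarrow> 'a::real_normed_vector) \<Rightarrow> real" where
  "wnorm n lam \<eta> u =
     Max (insert (inverse \<eta> * norm (u n)) ((\<lambda>i. inverse lam * norm (u i)) ` {1..n-1}))"

definition max_gap :: "nat \<Rightarrow> (nat \<Rightarrow> 'a::real_normed_vector) \<Rightarrow> (nat \<Rightarrow> 'a) \<Rightarrow> real" where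
  "max_gap n a u = (MAX i\<in>{1..n-1}. norm (u n + a i - u i))"

text \<open>Supremum and upper limit with the convention that they are \<open>0\<close> (not \<open>-\<infinity>\<close>) when there is
  nothing to range over; for the upper limit this means that \<open>x\<close> is not a limit point of \<open>S\<close>.\<close>

definition sup0 :: "'b set \<Rightarrow> ('b \<Rightarrow> ereal) \<Rightarrow> ereal" where
  "sup0 S f = (if S = {} then 0 else (SUP u\<in>S. f u))"

definition limsup0 :: "'b::topological_space \<Rightarrow> 'b set \<Rightarrow> ('b \<Rightarrow> ereal) \<Rightarrow> ereal" where
  "limsup0 x S f = (if at x within S = bot then 0 else Limsup (at x within S) f)"

end

theory Submission
  imports Defs
begin

text \<open>
  The function \<open>u \<mapsto> \<phi> (max_gap n a u)\<close> on the product of the sets \<open>\<Omega>\<^sub>i\<close> is continuous, and by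
  hypothesis its value at \<open>(xbar, \<dots>, xbar)\<close> exceeds its infimum by less than some
  \<open>\<epsilon>' < \<epsilon>\<close>.  Ekeland's variational principle with slope \<open>\<epsilon>'\<close>, for the weighted maximum
  norm, yields a tuple \<open>\<omega>\<close> at distance less than \<open>1\<close> from \<open>(xbar, \<dots>, xbar)\<close> at which all the
  difference quotients are at most \<open>\<epsilon>'\<close>.  For differentiable \<open>\<phi>\<close>, the quotients of
  \<open>max_gap\<close> itself are eventually at most \<open>\<epsilon>' / c\<close> for every
  \<open>0 < c < \<phi>' (max_gap n a \<omega>)\<close>.
\<close>

section \<open>Ekeland's variational principle in a complete metric space\<close>

text \<open>Each step of an iteration moves to a point of \<open>S x\<close>, the points whose
  decrease of \<open>f\<close> pays for their distance to \<open>x\<close>, and at least halves the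
  gap between \<open>f\<close> and its infimum on \<open>S x\<close>. The total decrease is finite,
  so the iterates are Cauchy; their limit \<open>z\<close> lies in every \<open>S (s k)\<close>, and
  the halving leaves no other point in \<open>S z\<close>. Lower semicontinuity is expressed by
  closed sublevel sets.\<close>

theorem (in Metric_space) ekeland:
  fixes f :: "'a \<Rightarrow> real"
  assumes "mcomplete" and "x0 \<in> M" and "0 < e"
    and bdd: "\<And>x. x \<in> M \<Longrightarrow> m \<le> f x"
    and lsc: "\<And>c. closedin mtopology {x \<in> M. f x \<le> c}"
  obtains z where "z \<in> M" and "f z + e * d z x0 \<le> f x0"
    and "\<And>u. u \<in> M \<Longrightarrow> u \<noteq> z \<Longrightarrow> f z < f u + e * d u z"
proof -
  define S where "S x = {u \<in> M. f u + e * d u x \<le> f x}" for x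
  have S_trans: "u \<in> S x" if "u \<in> S y" "y \<in> S x" "x \<in> M" for u x y
  proof -
    have "e * d u x \<le> e * (d u y + d y x)"
      using that triangle[of u y x] \<open>0 < e\<close> by (auto simp: S_def)
    then show ?thesis using that by (auto simp: S_def algebra_simps)
  qed
  \<comment> \<open>The infimum is eliminated in favour of all \<open>u\<close> in
    \<open>S x\<close>, so that the bound can later be tested at a competitor of the limit point. If
    \<open>f x\<close> is already the infimum, \<open>x\<close> itself serves; otherwise the
    midpoint of \<open>f x\<close> and the infimum lies strictly above the infimum.\<close>
  have step: "\<exists>y. y \<in> M \<and> (y \<in> S x \<and> (\<forall>u\<in>S x. f y \<le> (f x + f u) / 2))" if "x \<in> M" for x
  proof -
    have x: "x \<in> S x" using that by (simp add: S_def)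
    have bb: "bdd_below (f ` S x)"
      using bdd by (auto simp: S_def intro!: bdd_belowI[where m = m])
    let ?I = "Inf (f ` S x)"
    have I: "?I \<le> f u" if "u \<in> S x" for u
      using bb that by (simp add: cINF_lower)
    show ?thesis
    proof (cases "?I = f x")
      case True
      then show ?thesis using x that I by force
    next
      case False
      then have "?I < (f x + ?I) / 2" using I[OF x] by simp
      then obtain y where "y \<in> S x" "f y < (f x + ?I) / 2"
        using cINF_less_iff[OF _ bb] x by blast
      moreover have "(f x + ?I) / 2 \<le> (f x + f u) / 2" if "u \<in> S x" for u
        using I[OF that] by simp
      ultimately show ?thesis by (fastforce simp: S_def)
    qed
  qed
  have "\<exists>s. \<forall>k. (s k \<in> M \<and> (k = 0 \<longrightarrow> s k = x0)) \<and>
      (s (Suc k) \<in> S (s k) \<and> (\<forall>u\<in>S (s k). f (s (Suc k)) \<le> (f (s k) + f u) / 2))"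
    by (rule dependent_nat_choice) (use \<open>x0 \<in> M\<close> step in auto)
  then obtain s where sM: "\<And>k. s k \<in> M" and s0: "s 0 = x0"
    and sS: "\<And>k. s (Suc k) \<in> S (s k)"
    and half: "\<And>k u. u \<in> S (s k) \<Longrightarrow> f (s (Suc k)) \<le> (f (s k) + f u) / 2"
    by blast
  have s_mono: "s l \<in> S (s k)" if "k \<le> l" for k l
    using that
  proof (induction rule: dec_induct)
    case base
    show ?case using sM by (simp add: S_def)
  next
    case (step l)
    then show ?case using S_trans[OF sS step.IH sM] by simp
  qed
  have "decseq (\<lambda>k. f (s k))"
  proof (rule decseq_SucI)
    show "f (s (Suc k)) \<le> f (s k)" for k
      using sS[of k] \<open>0 < e\<close> mult_nonneg_nonneg[of e "d (s (Suc k)) (s k)"] by (simp add: S_def del: mult_nonneg_nonneg)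
  qed
  then obtain L where L: "(\<lambda>k. f (s k)) \<longlonglongrightarrow> L" and L_le: "\<And>k. L \<le> f (s k)"
    using decseq_convergent[of "\<lambda>k. f (s k)" m] bdd sM by blast
  have "MCauchy s"
    unfolding MCauchy_def
  proof (intro conjI allI impI)
    show "range s \<subseteq> M" using sM by auto
    fix r :: real assume "0 < r"
    then have "\<forall>\<^sub>F k in sequentially. f (s k) < L + e * r / 2"
      using \<open>0 < e\<close> by (intro order_tendstoD(2)[OF L]) simp
    then obtain N where N: "f (s N) < L + e * r / 2"
      by (auto simp: eventually_sequentially)
    \<comment> \<open>Membership of \<open>s k\<close> in \<open>S (s N)\<close> bounds the distance
      by the remaining decrease: \<open>e * d (s k) (s N)\<close> is at most
      \<open>f (s N) - L\<close>.\<close>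
    have near: "d (s k) (s N) < r / 2" if "N \<le> k" for k
    proof -
      have "e * d (s k) (s N) < e * (r / 2)"
        using s_mono[OF that] L_le[of k] N by (simp add: S_def)
      then show ?thesis using \<open>0 < e\<close> by simp
    qed
    have "d (s k) (s l) < r" if "N \<le> k" "N \<le> l" for k l
      using triangle[of "s k" "s N" "s l"] near[OF that(1)] near[OF that(2)] sM commute[of "s N" "s l"]
      by simp
    then show "\<exists>N. \<forall>k l. N \<le> k \<longrightarrow> N \<le> l \<longrightarrow> d (s k) (s l) < r" by blast
  qed
  then obtain z where lim: "limitin mtopology s z sequentially"
    using \<open>mcomplete\<close> by (auto simp: mcomplete_def)
  then have zM: "z \<in> M" and dz: "(\<lambda>k. d (s k) z) \<longlonglongrightarrow> 0"
    by (auto simp: limitin_metric_dist_null)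
  \<comment> \<open>Semicontinuity enters here: a closed sublevel set that eventually contains the
    iterates contains their limit.\<close>
  have lim_le: "f z \<le> c" if "\<forall>\<^sub>F k in sequentially. f (s k) \<le> c" for c
  proof -
    have "z \<in> {x \<in> M. f x \<le> c}"
      by (rule limitin_closedin[OF lim lsc]) (use that sM in auto)
    then show ?thesis by simp
  qed
  have zS: "z \<in> S (s k)" for k
  proof -
    \<comment> \<open>The slack \<open>r\<close> absorbs the replacement of
      \<open>d (s l) (s k)\<close> by \<open>d z (s k)\<close>, so that the bound on
      \<open>f (s l)\<close> no longer depends on \<open>l\<close>.\<close>
    have "f z \<le> f (s k) - e * d z (s k) + r" if "0 < r" for r
    proof (rule lim_le)
      have "\<forall>\<^sub>F l in sequentially. d (s l) z < r / e"
        using dz \<open>0 < e\<close> \<open>0 < r\<close> by (intro order_tendstoD(2)[OF dz]) simp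
      then show "\<forall>\<^sub>F l in sequentially. f (s l) \<le> f (s k) - e * d z (s k) + r"
        using eventually_ge_at_top[of k]
      proof eventually_elim
        case (elim l)
        have "d z (s k) \<le> r / e + d (s l) (s k)"
          using triangle[OF zM sM[of l] sM[of k]] elim(1) commute[of z "s l"] by linarith
        then have "e * d z (s k) \<le> r + e * d (s l) (s k)"
          using \<open>0 < e\<close> by (simp add: field_simps)
        then show ?case using s_mono[OF elim(2)] by (simp add: S_def)
      qed
    qed
    then have "f z \<le> f (s k) - e * d z (s k)" by (rule field_le_epsilon)
    then show ?thesis using zM by (simp add: S_def)
  qed
  have "f z \<le> L + r" if "0 < r" for r
    using order_tendstoD(2)[OF L, of "L + r"] that
    by (intro lim_le) (auto elim: eventually_mono)
  then have zL: "f z \<le> L" by (rule field_le_epsilon)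
  show thesis
  proof
    show "z \<in> M" by (rule zM)
    show "f z + e * d z x0 \<le> f x0" using zS[of 0] by (simp add: S_def s0)
    fix u assume u: "u \<in> M" "u \<noteq> z"
    show "f z < f u + e * d u z"
    proof (rule ccontr)
      assume "\<not> f z < f u + e * d u z"
      \<comment> \<open>By transitivity \<open>u\<close> lies in every \<open>S (s k)\<close>.
        Passing to the limit in the halving inequality gives \<open>L \<le> f u\<close>, whereas
        \<open>f u + e * d u z \<le> f z \<le> L\<close>; hence \<open>d u z\<close> would
        vanish.\<close>
      then have uz: "u \<in> S z" using u by (simp add: S_def)
      then have "f (s (Suc k)) \<le> (f (s k) + f u) / 2" for k
        by (intro half S_trans[OF _ zS sM])
      moreover have "(\<lambda>k. (f (s k) + f u) / 2) \<longlonglongrightarrow> (L + f u) / 2"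
        by (intro tendsto_intros L) simp
      ultimately have "L \<le> (L + f u) / 2"
        using LIMSEQ_le[OF LIMSEQ_Suc[OF L]] by blast
      then have "e * d u z \<le> 0" using zL uz by (simp add: S_def)
      moreover have "0 < d u z" using u zM zero[of u z] nonneg[of u z] by linarith
      ultimately show False using \<open>0 < e\<close> mult_pos_pos[of e "d u z"] by linarith
    qed
  qed
qed

section \<open>Products of closed sets under a weighted maximum metric\<close>

lemma tendsto_MAX:
  fixes f :: "'i \<Rightarrow> 'b \<Rightarrow> 'c::linorder_topology"
  assumes "finite I" "I \<noteq> {}" "\<And>i. i \<in> I \<Longrightarrow> (f i \<longlongrightarrow> l i) F"
  shows "((\<lambda>x. MAX i\<in>I. f i x) \<longlongrightarrow> (MAX i\<in>I. l i)) F"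
  using assms by (induction rule: finite_ne_induct) (auto intro!: tendsto_max)

locale weighted_product =
  fixes I :: "'i set" and w :: "'i \<Rightarrow> real" and C :: "'i \<Rightarrow> 'a::banach set"
  assumes finite_I: "finite I" and I_ne: "I \<noteq> {}"
    and w_pos: "\<And>i. i \<in> I \<Longrightarrow> 0 < w i"
    and closed_C: "\<And>i. i \<in> I \<Longrightarrow> closed (C i)"
begin

definition maxdist :: "('i \<Rightarrow> 'a) \<Rightarrow> ('i \<Rightarrow> 'a) \<Rightarrow> real" where
  "maxdist u v = (MAX i\<in>I. w i * norm (u i - v i))"

lemma le_maxdist: "i \<in> I \<Longrightarrow> w i * norm (u i - v i) \<le> maxdist u v"
  using finite_I by (simp add: maxdist_def)

lemma maxdist_le_iff: "maxdist u v \<le> r \<longleftrightarrow> (\<forall>i\<in>I. w i * norm (u i - v i) \<le> r)"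
  using finite_I I_ne by (simp add: maxdist_def)

text \<open>Distance zero forces equality because the tuples are extensional: they agree outside
  \<open>I\<close>, and positive weights make them agree on \<open>I\<close>.\<close>

sublocale Metric_space "Pi\<^sub>E I C" maxdist
proof
  fix u v z :: "'i \<Rightarrow> 'a"
  obtain i where i: "i \<in> I" using I_ne by auto
  have "0 \<le> w i * norm (u i - v i)" using w_pos[OF i] by simp
  then show nn: "0 \<le> maxdist u v" using le_maxdist[OF i] by (rule order_trans)
  show "maxdist u v = maxdist v u" by (simp add: maxdist_def norm_minus_commute)
  {
    assume uv: "u \<in> Pi\<^sub>E I C" "v \<in> Pi\<^sub>E I C"
    have "u = v" if "maxdist u v = 0"
    proof (rule PiE_ext[OF uv])
      fix j assume j: "j \<in> I"
      then show "u j = v j"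
        using le_maxdist[OF j, of u v] w_pos[OF j] that by (simp add: mult_le_0_iff)
    qed
    moreover have "maxdist u u \<le> 0" by (simp add: maxdist_le_iff)
    ultimately show "maxdist u v = 0 \<longleftrightarrow> u = v" using nn by auto
  }
  show "maxdist u z \<le> maxdist u v + maxdist v z"
    unfolding maxdist_le_iff
  proof
    fix j assume j: "j \<in> I"
    have "w j * norm (u j - z j) \<le> w j * (norm (u j - v j) + norm (v j - z j))"
      using w_pos[OF j] norm_triangle_ineq[of "u j - v j" "v j - z j"] by simp
    also have "\<dots> \<le> maxdist u v + maxdist v z"
      using le_maxdist[OF j, of u v] le_maxdist[OF j, of v z] by (simp add: distrib_left)
    finally show "w j * norm (u j - z j) \<le> maxdist u v + maxdist v z" .
  qed
qed

lemma norm_diff_le_maxdist: "i \<in> I \<Longrightarrow> norm (u i - v i) \<le> maxdist u v / w i"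
  using le_maxdist[of i u v] w_pos[of i] by (simp add: field_simps)

lemma limitin_coordinate:
  assumes "limitin mtopology s l F" "i \<in> I"
  shows "((\<lambda>k. s k i) \<longlongrightarrow> l i) F"
proof -
  have "((\<lambda>k. maxdist (s k) l / w i) \<longlongrightarrow> 0 / w i) F"
    using assms w_pos[of i] by (intro tendsto_divide) (auto simp: limitin_metric_dist_null)
  then have "((\<lambda>k. maxdist (s k) l / w i) \<longlongrightarrow> 0) F" by simp
  then have "((\<lambda>k. s k i - l i) \<longlongrightarrow> 0) F"
    by (rule Lim_null_comparison[rotated]) (simp add: norm_diff_le_maxdist assms)
  then show ?thesis by (simp add: LIM_zero_iff)
qed

text \<open>Coordinates of a Cauchy sequence are Cauchy in the Banach space, and closedness keeps
  their limits in \<open>C i\<close>. Since \<open>I\<close> is finite, coordinatewise convergence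
  gives convergence of the maximum.\<close>

lemma mcomplete_maxdist: "mcomplete"
  unfolding mcomplete_def
proof (intro allI impI)
  fix s assume s: "MCauchy s"
  then have sM: "s k \<in> Pi\<^sub>E I C" for k by (auto simp: MCauchy_def)
  have "\<exists>l. l \<in> C i \<and> (\<lambda>k. s k i) \<longlonglongrightarrow> l" if i: "i \<in> I" for i
  proof -
    have "Cauchy (\<lambda>k. s k i)"
    proof (rule CauchyI)
      fix r :: real assume "0 < r"
      then have "0 < r * w i" using w_pos[OF i] by simp
      then obtain N where N: "\<And>k l. N \<le> k \<Longrightarrow> N \<le> l \<Longrightarrow> maxdist (s k) (s l) < r * w i"
        using s unfolding MCauchy_def by blast
      have "norm (s k i - s l i) < r" if "k \<ge> N" "l \<ge> N" for k l
      proof -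
        have "w i * norm (s k i - s l i) < w i * r"
          using le_maxdist[OF i, of "s k" "s l"] N[OF that] by (simp add: mult.commute)
        then show ?thesis using w_pos[OF i] by simp
      qed
      then show "\<exists>N. \<forall>k\<ge>N. \<forall>l\<ge>N. norm (s k i - s l i) < r" by blast
    qed
    then obtain l where l: "(\<lambda>k. s k i) \<longlonglongrightarrow> l" by (auto simp: Cauchy_convergent_iff convergent_def)
    moreover have "l \<in> C i"
      using sM i by (intro closed_sequentially[OF closed_C[OF i] _ l]) auto
    ultimately show ?thesis by blast
  qed
  then obtain l where l: "\<And>i. i \<in> I \<Longrightarrow> l i \<in> C i" "\<And>i. i \<in> I \<Longrightarrow> (\<lambda>k. s k i) \<longlonglongrightarrow> l i"
    by metis
  \<comment> \<open>Restriction makes the chosen limits an extensional tuple, hence a point of the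
    product.\<close>
  let ?l = "restrict l I"
  have "(\<lambda>k. maxdist (s k) ?l) \<longlonglongrightarrow> (MAX i\<in>I. 0)"
    unfolding maxdist_def
  proof (rule tendsto_MAX[OF finite_I I_ne])
    fix i assume i: "i \<in> I"
    have "(\<lambda>k. w i * norm (s k i - ?l i)) \<longlonglongrightarrow> w i * norm (l i - ?l i)"
      by (intro tendsto_intros l i)
    then show "(\<lambda>k. w i * norm (s k i - ?l i)) \<longlonglongrightarrow> 0" using i by simp
  qed
  moreover have "(MAX i\<in>I. 0) = (0::real)" using I_ne by (simp add: image_constant_conv)
  ultimately have "limitin mtopology s ?l sequentially"
    using l sM by (simp add: limitin_metric_dist_null)
  then show "\<exists>x. limitin mtopology s x sequentially" by blast
qed

end

section \<open>Weighted norm, gap of a tuple and distance of the shifted sets\<close>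

lemma wnorm_eq_MAX:
  assumes "1 \<le> n"
  shows "wnorm n lam \<eta> u = (MAX i\<in>{1..n}. (if i = n then inverse \<eta> else inverse lam) * norm (u i))"
proof -
  have "{1..n} = insert n {1..n-1}" using assms by auto
  moreover have "(\<lambda>i. (if i = n then inverse \<eta> else inverse lam) * norm (u i)) ` {1..n-1}
      = (\<lambda>i. inverse lam * norm (u i)) ` {1..n-1}"
    using assms by (intro image_cong) auto
  ultimately show ?thesis by (simp add: wnorm_def del: One_nat_def)
qed

lemma max_gap_nonneg:
  assumes "2 \<le> n"
  shows "0 \<le> max_gap n a u"
proof -
  have "0 \<le> norm (u n + a 1 - u 1)" by simp
  also have "\<dots> \<le> max_gap n a u" using assms unfolding max_gap_def by (intro Max_ge) auto
  finally show ?thesis .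
qed

lemma tendsto_max_gap:
  assumes "2 \<le> n" "\<And>i. i \<in> {1..n} \<Longrightarrow> ((\<lambda>x. s x i) \<longlongrightarrow> l i) F"
  shows "((\<lambda>x. max_gap n a (s x)) \<longlongrightarrow> max_gap n a l) F"
  unfolding max_gap_def
  by (rule tendsto_MAX) (use assms in \<open>auto intro!: tendsto_intros\<close>)

text \<open>A vanishing gap would give \<open>u n = u i - a i\<close> for all \<open>i < n\<close>,
  making \<open>u n\<close> a common point of sets with empty intersection.\<close>

lemma max_gap_pos:
  assumes "2 \<le> n" and u: "u \<in> Pi\<^sub>E {1..n} \<Omega>"
    and empty: "(\<Inter>i\<in>{1..n-1}. (\<lambda>x. x - a i) ` \<Omega> i) \<inter> \<Omega> n = {}"
  shows "0 < max_gap n a u"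
proof (rule ccontr)
  assume "\<not> 0 < max_gap n a u"
  have "u n \<in> (\<lambda>x. x - a i) ` \<Omega> i" if i: "i \<in> {1..n-1}" for i
  proof
    have "norm (u n + a i - u i) \<le> max_gap n a u"
      unfolding max_gap_def using i by (intro Max_ge) auto
    then have "norm (u n + a i - u i) \<le> 0"
      using \<open>\<not> 0 < max_gap n a u\<close> by linarith
    then show "u n = u i - a i" by (simp add: eq_diff_eq)
    show "u i \<in> \<Omega> i" using i by (intro PiE_mem[OF u]) auto
  qed
  moreover have "u n \<in> \<Omega> n" using \<open>2 \<le> n\<close> by (intro PiE_mem[OF u]) auto
  ultimately have "u n \<in> (\<Inter>i\<in>{1..n-1}. (\<lambda>x. x - a i) ` \<Omega> i) \<inter> \<Omega> n"
    by blast
  then show False unfolding empty by (rule emptyE)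
qed

lemma set_dist_nonneg:
  fixes \<Omega> :: "nat \<Rightarrow> 'a::real_normed_vector set"
  assumes "2 \<le> n" "Pi\<^sub>E {1..n} \<Omega> \<noteq> {}"
  shows "0 \<le> set_dist n \<Omega>"
  unfolding set_dist_def
proof (rule cINF_greatest[OF assms(2)])
  fix u :: "nat \<Rightarrow> 'a"
  have "0 \<le> norm (u n - u 1)" by simp
  also have "\<dots> \<le> (MAX i\<in>{1..n-1}. norm (u n - u i))" using assms by (intro Max_ge) auto
  finally show "0 \<le> (MAX i\<in>{1..n-1}. norm (u n - u i))" .
qed

text \<open>Subtracting \<open>a i\<close> from the first \<open>n-1\<close> coordinates turns the
  gap of \<open>u\<close> into one of the values under the infimum. Nonnegativity of the infimum is
  recorded because \<phi> is monotone only on the half-line.\<close>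

lemma set_dist_le_max_gap:
  fixes a u :: "nat \<Rightarrow> 'a::real_normed_vector"
  assumes "2 \<le> n" and u: "u \<in> Pi\<^sub>E {1..n} \<Omega>"
  defines "\<Omega>' \<equiv> (\<lambda>i. (\<lambda>x. x - a i) ` \<Omega> i)(n := \<Omega> n)"
  shows "0 \<le> set_dist n \<Omega>'" and "set_dist n \<Omega>' \<le> max_gap n a u"
proof -
  define v where "v = (\<lambda>i\<in>{1..n}. if i = n then u n else u i - a i)"
  have v: "v \<in> Pi\<^sub>E {1..n} \<Omega>'" using u \<open>2 \<le> n\<close> by (auto simp: v_def \<Omega>'_def PiE_iff)
  then show "0 \<le> set_dist n \<Omega>'" using \<open>2 \<le> n\<close> by (intro set_dist_nonneg) auto
  have "0 \<le> (MAX i\<in>{1..n-1}. norm (y n - y i))" for y :: "nat \<Rightarrow> 'a"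
    using \<open>2 \<le> n\<close> max_gap_nonneg[of n "\<lambda>_. 0" y] by (simp add: max_gap_def)
  then have "set_dist n \<Omega>' \<le> (MAX i\<in>{1..n-1}. norm (v n - v i))"
    unfolding set_dist_def by (intro cINF_lower[OF _ v] bdd_belowI[where m = 0]) auto
  also have "\<dots> = max_gap n a u"
    unfolding max_gap_def
    by (intro arg_cong[where f = Max] image_cong) (auto simp: v_def algebra_simps)
  finally show "set_dist n \<Omega>' \<le> max_gap n a u" .
qed

text \<open>The difference quotient exceeds \<open>c\<close> near \<open>x\<close>. The filter
  \<open>nhds x\<close> replaces \<open>at x\<close> so that the estimate can be composed with a
  function that may take the value \<open>x\<close> at nearby points.\<close>

lemma deriv_pos_eventually_slope_ge:
  fixes f :: "real \<Rightarrow> real"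
  assumes "f differentiable at x" "c < deriv f x"
  shows "\<forall>\<^sub>F y in nhds x. y < x \<longrightarrow> c * (x - y) \<le> f x - f y"
proof -
  have "(f has_real_derivative deriv f x) (at x)"
    using assms(1) by (simp add: DERIV_deriv_iff_real_differentiable)
  then have "\<forall>\<^sub>F y in at x. c < (f y - f x) / (y - x)"
    using order_tendstoD(1)[OF has_field_derivativeD assms(2)] by simp
  then have "\<forall>\<^sub>F y in nhds x. y \<noteq> x \<longrightarrow> c < (f y - f x) / (y - x)"
    by (simp add: eventually_at_filter)
  then show ?thesis
    by eventually_elim (auto simp: field_simps)
qed

section \<open>Ekeland's principle applied to \<phi> of the gap\<close>

theorem theorem3p1:
  fixes n :: nat
    and \<Omega> :: "nat \<Rightarrow> 'a::banach set"
    and xbar :: 'a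
    and a :: "nat \<Rightarrow> 'a"
    and \<epsilon> :: real
    and \<phi> :: "real \<Rightarrow> real"
  assumes "n \<ge> 2"
    and "\<And>i. i \<in> {1..n} \<Longrightarrow> closed (\<Omega> i)"
    and "xbar \<in> (\<Inter>i\<in>{1..n}. \<Omega> i)"
    and "\<epsilon> > 0"
    and "\<phi> \<in> class_C"
    and "(\<Inter>i\<in>{1..n-1}. (\<lambda>x. x - a i) ` \<Omega> i) \<inter> \<Omega> n = {}"
    and "\<phi> (MAX i\<in>{1..n-1}. norm (a i))
           < \<phi> (set_dist n ((\<lambda>i. (\<lambda>x. x - a i) ` \<Omega> i)(n := \<Omega> n))) + \<epsilon>"
  shows "\<forall>lam>0. \<forall>\<eta>>0. \<exists>\<omega>\<in>Pi\<^sub>E {1..n} \<Omega>.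
      (\<forall>i\<in>{1..n-1}. \<omega> i \<in> ball xbar lam) \<and> \<omega> n \<in> ball xbar \<eta>
    \<and> sup0 (Pi\<^sub>E {1..n} \<Omega> - {\<omega>})
        (\<lambda>u. ereal ((\<phi> (max_gap n a \<omega>) - \<phi> (max_gap n a u)) / wnorm n lam \<eta> (\<lambda>i. u i - \<omega> i))) < ereal \<epsilon>
    \<and> 0 < max_gap n a \<omega> \<and> max_gap n a \<omega> \<le> (MAX i\<in>{1..n-1}. norm (a i))
    \<and> limsup0 \<omega> (Pi\<^sub>E {1..n} \<Omega>)
        (\<lambda>u. ereal ((\<phi> (max_gap n a \<omega>) - \<phi> (max_gap n a u)) / wnorm n lam \<eta> (\<lambda>i. u i - \<omega> i))) < ereal \<epsilon>
    \<and> (\<phi> differentiable at (max_gap n a \<omega>) \<longrightarrow>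
        ereal (deriv \<phi> (max_gap n a \<omega>)) * limsup0 \<omega> (Pi\<^sub>E {1..n} \<Omega>)
          (\<lambda>u. ereal ((max_gap n a \<omega> - max_gap n a u) / wnorm n lam \<eta> (\<lambda>i. u i - \<omega> i))) < ereal \<epsilon>)"
proof (intro allI impI)
  note One_nat_def[simp del]
  note n = \<open>n \<ge> 2\<close>
  fix lam \<eta> :: real
  assume "0 < lam" "0 < \<eta>"
  let ?M = "Pi\<^sub>E {1..n} \<Omega>"
  let ?g = "max_gap n a"
  let ?m = "MAX i\<in>{1..n-1}. norm (a i)"
  let ?\<delta> = "set_dist n ((\<lambda>i. (\<lambda>x. x - a i) ` \<Omega> i)(n := \<Omega> n))"
  let ?w = "\<lambda>i. if i = n then inverse \<eta> else inverse lam"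
  interpret weighted_product "{1..n}" ?w \<Omega>
    by unfold_locales (use n assms(2) \<open>0 < lam\<close> \<open>0 < \<eta>\<close> in auto)
  have wnorm: "wnorm n lam \<eta> (\<lambda>i. u i - v i) = maxdist u v" for u v :: "nat \<Rightarrow> 'a"
    using n unfolding maxdist_def by (intro wnorm_eq_MAX) simp
  have \<phi>_mono: "strict_mono_on {0..} \<phi>" and \<phi>_cont: "continuous_on {0..} \<phi>"
    using \<open>\<phi> \<in> class_C\<close> by (auto simp: class_C_def)
  then have \<phi>_le: "\<phi> s \<le> \<phi> t \<longleftrightarrow> s \<le> t" if "0 \<le> s" "0 \<le> t" for s t
    using that by (simp add: strict_mono_on_less_eq)
  have g_nonneg: "0 \<le> ?g u" for u using n by (rule max_gap_nonneg)

  define x0 where "x0 = (\<lambda>i\<in>{1..n}. xbar)"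
  have x0: "x0 \<in> ?M" using assms(3) by (auto simp: x0_def)
  have gx0: "?g x0 = ?m"
    unfolding max_gap_def
    by (intro arg_cong[where f = Max] image_cong) (use n in \<open>auto simp: x0_def\<close>)
  have low: "\<phi> ?\<delta> \<le> \<phi> (?g u)" if "u \<in> ?M" for u
    using set_dist_le_max_gap[OF n that, of a] g_nonneg[of u] by (simp add: \<phi>_le)
  \<comment> \<open>The midpoint of \<epsilon> and the nonnegative part of the excess of
    \<open>\<phi> (?g x0)\<close> over the lower bound \<open>\<phi> ?\<delta>\<close>. It is
    positive and lies strictly between the excess and \<epsilon>: the former gives the open balls,
    the latter the strict final bounds.\<close>
  define e where "e = (max 0 (\<phi> ?m - \<phi> ?\<delta>) + \<epsilon>) / 2"
  have e: "0 < e" "e < \<epsilon>" "\<phi> ?m - \<phi> ?\<delta> < e"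
    using assms(4,7) by (auto simp: e_def max_def)

  have lsc: "closedin mtopology {u \<in> ?M. \<phi> (?g u) \<le> c}" for c
    unfolding metric_closedin_iff_sequentially_closed
  proof (intro conjI allI impI, blast)
    fix s l
    assume sl: "range s \<subseteq> {u \<in> ?M. \<phi> (?g u) \<le> c} \<and> limitin mtopology s l sequentially"
    then have "(\<lambda>k. ?g (s k)) \<longlonglongrightarrow> ?g l"
      by (intro tendsto_max_gap n limitin_coordinate) auto
    then have "(\<lambda>k. \<phi> (?g (s k))) \<longlonglongrightarrow> \<phi> (?g l)"
      by (intro continuous_on_tendsto_compose[OF \<phi>_cont]) (simp_all add: g_nonneg)
    moreover have "\<phi> (?g (s k)) \<le> c" for k using sl by auto
    ultimately have "\<phi> (?g l) \<le> c" by (intro LIMSEQ_le_const2) auto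
    then show "l \<in> {u \<in> ?M. \<phi> (?g u) \<le> c}" using sl by (auto simp: limitin_metric)
  qed
  obtain \<omega> where \<omega>: "\<omega> \<in> ?M" and dist_\<omega>: "\<phi> (?g \<omega>) + e * maxdist \<omega> x0 \<le> \<phi> (?g x0)"
    and min_\<omega>: "\<And>u. u \<in> ?M \<Longrightarrow> u \<noteq> \<omega> \<Longrightarrow> \<phi> (?g \<omega>) < \<phi> (?g u) + e * maxdist u \<omega>"
    using ekeland[OF mcomplete_maxdist x0 \<open>0 < e\<close>, of "\<phi> ?\<delta>" "\<lambda>u. \<phi> (?g u)", OF low lsc] by blast

  \<comment> \<open>The decrease of \<phi> from \<open>x0\<close> to \<omega> is below
    \<open>e\<close>, so the weighted distance is below \<open>1\<close>; unscaling the weights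
    gives the radii \<open>lam\<close> and \<eta>.\<close>
  have "e * maxdist \<omega> x0 < e * 1" using dist_\<omega> low[OF \<omega>] e(3) gx0 by simp
  then have near: "maxdist \<omega> x0 < 1" using \<open>0 < e\<close> by simp
  have \<omega>_near: "norm (\<omega> i - xbar) < (if i = n then \<eta> else lam)" if "i \<in> {1..n}" for i
    using le_less_trans[OF le_maxdist[OF that, of \<omega> x0] near] that \<open>0 < lam\<close> \<open>0 < \<eta>\<close>
    by (simp add: x0_def field_simps split: if_splits)
  have "\<omega> i \<in> ball xbar lam" if "i \<in> {1..n-1}" for i
  proof -
    have "i \<in> {1..n}" "i \<noteq> n" using that n by auto
    then show ?thesis using \<omega>_near[of i] by (simp add: dist_norm norm_minus_commute)
  qed
  moreover have "\<omega> n \<in> ball xbar \<eta>"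
    using \<omega>_near[of n] n by (auto simp: dist_norm norm_minus_commute)
  ultimately have balls: "\<forall>i\<in>{1..n-1}. \<omega> i \<in> ball xbar lam" "\<omega> n \<in> ball xbar \<eta>" by blast+
  have g_pos: "0 < ?g \<omega>" using n \<omega> assms(6) by (rule max_gap_pos)
  have "\<phi> (?g \<omega>) \<le> \<phi> (?g x0)"
    using dist_\<omega> mult_nonneg_nonneg[of e "maxdist \<omega> x0"] \<open>0 < e\<close> nonneg[of \<omega> x0] by linarith
  then have g_le: "?g \<omega> \<le> ?m" using \<phi>_le[OF g_nonneg[of \<omega>] g_nonneg[of x0]] gx0 by simp

  have d_pos: "0 < maxdist u \<omega>" if "u \<in> ?M" "u \<noteq> \<omega>" for u
    using that \<omega> zero[of u \<omega>] nonneg[of u \<omega>] by linarith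
  have quot: "(\<phi> (?g \<omega>) - \<phi> (?g u)) / maxdist u \<omega> \<le> e" if "u \<in> ?M" "u \<noteq> \<omega>" for u
    using min_\<omega>[OF that] d_pos[OF that] by (simp add: field_simps)
  have ev_M: "\<forall>\<^sub>F u in at \<omega> within ?M. u \<in> ?M \<and> u \<noteq> \<omega>"
    by (auto simp: eventually_at_filter)
  \<comment> \<open>The condition \<open>0 \<le> b\<close> covers an isolated \<omega>, where the
    upper limit is \<open>0\<close> by convention.\<close>
  have limsup0_le: "limsup0 \<omega> ?M f \<le> ereal b"
    if "0 \<le> b" "\<forall>\<^sub>F u in at \<omega> within ?M. f u \<le> ereal b" for f b
    using that by (auto simp: limsup0_def intro: Limsup_bounded)

  let ?q = "\<lambda>u. ereal ((\<phi> (?g \<omega>) - \<phi> (?g u)) / wnorm n lam \<eta> (\<lambda>i. u i - \<omega> i))"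
  have "sup0 (?M - {\<omega>}) ?q \<le> ereal e"
    using quot \<open>0 < e\<close> by (auto simp: sup0_def wnorm intro!: SUP_least)
  then have sup: "sup0 (?M - {\<omega>}) ?q < ereal \<epsilon>"
    using e(2) by (auto intro: le_less_trans)
  have "limsup0 \<omega> ?M ?q \<le> ereal e"
    by (rule limsup0_le) (use \<open>0 < e\<close> ev_M quot in \<open>auto simp: wnorm elim!: eventually_mono\<close>)
  then have limsup: "limsup0 \<omega> ?M ?q < ereal \<epsilon>"
    using e(2) by (auto intro: le_less_trans)

  \<comment> \<open>Upper limit of the gap quotients for differentiable \<phi>\<close>
  let ?r = "\<lambda>u. ereal ((?g \<omega> - ?g u) / wnorm n lam \<eta> (\<lambda>i. u i - \<omega> i))"
  have diff: "ereal (deriv \<phi> (?g \<omega>)) * limsup0 \<omega> ?M ?r < ereal \<epsilon>"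
    if d: "\<phi> differentiable at (?g \<omega>)"
  proof -
    let ?D = "deriv \<phi> (?g \<omega>)"
    have "(\<phi> has_real_derivative ?D) (at (?g \<omega>))"
      using d by (simp add: DERIV_deriv_iff_real_differentiable)
    \<comment> \<open>Positivity of the gap puts \<open>?g \<omega>\<close> in the interior of the
      half-line on which \<phi> is increasing.\<close>
    then have "0 \<le> ?D"
      using g_pos strict_mono_on_imp_mono_on[OF \<phi>_mono]
      by (intro mono_on_imp_deriv_nonneg) auto
    show ?thesis
    proof (cases "?D = 0")
      case True
      then show ?thesis using \<open>0 < \<epsilon>\<close> by (simp flip: zero_ereal_def)
    next
      case False
      with \<open>0 \<le> ?D\<close> have D: "0 < ?D" by simp
      then have "?D * e / \<epsilon> < ?D" using e by (simp add: field_simps)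
      \<comment> \<open>The lower bound on \<open>c\<close> is exactly what makes
        \<open>?D * (e / c) < \<epsilon>\<close>; the upper bound makes \<open>c\<close> an
        admissible slope for \<phi>.\<close>
      then obtain c where c: "?D * e / \<epsilon> < c" "c < ?D" using dense by blast
      moreover have "0 < ?D * e / \<epsilon>" using D e by simp
      ultimately have "0 < c" by linarith
      \<comment> \<open>The filter here comes from the product topology on functions, so the
        coordinates converge by continuity of the projections.\<close>
      have "((\<lambda>u. ?g u) \<longlongrightarrow> ?g \<omega>) (at \<omega> within ?M)"
      proof (rule tendsto_max_gap[OF n])
        show "((\<lambda>u. u i) \<longlongrightarrow> \<omega> i) (at \<omega> within ?M)" for i
        proof -
          have "continuous_on ?M (\<lambda>u. u i)"
            by (rule continuous_on_subset[OF continuous_on_product_coordinates subset_UNIV])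
          then show ?thesis using \<omega> by (simp add: continuous_on_def)
        qed
      qed
      then have "\<forall>\<^sub>F u in at \<omega> within ?M. ?g u < ?g \<omega> \<longrightarrow> c * (?g \<omega> - ?g u) \<le> \<phi> (?g \<omega>) - \<phi> (?g u)"
        using deriv_pos_eventually_slope_ge[OF d c(2)] by (auto simp: filterlim_iff)
      then have "\<forall>\<^sub>F u in at \<omega> within ?M. ?r u \<le> ereal (e / c)"
        using ev_M
      proof eventually_elim
        case (elim u)
        then have du: "0 < maxdist u \<omega>" using d_pos by blast
        \<comment> \<open>The slope bound serves only where the gap decreases; elsewhere the left
          side is nonpositive.\<close>
        have "c * (?g \<omega> - ?g u) \<le> e * maxdist u \<omega>"
        proof (cases "?g u < ?g \<omega>")
          case True
          then show ?thesis using elim min_\<omega>[of u] by simp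
        next
          case False
          then have "c * (?g \<omega> - ?g u) \<le> 0" using \<open>0 < c\<close> by (simp add: mult_le_0_iff)
          also have "0 \<le> e * maxdist u \<omega>" using \<open>0 < e\<close> by simp
          finally show ?thesis .
        qed
        then show ?case using du \<open>0 < c\<close> by (simp add: wnorm field_simps)
      qed
      then have "limsup0 \<omega> ?M ?r \<le> ereal (e / c)"
        using \<open>0 < e\<close> \<open>0 < c\<close> by (intro limsup0_le) auto
      then have "ereal ?D * limsup0 \<omega> ?M ?r \<le> ereal ?D * ereal (e / c)"
        using D by (intro ereal_mult_left_mono) auto
      also have "\<dots> < ereal \<epsilon>"
        using c(1) \<open>0 < c\<close> \<open>0 < \<epsilon>\<close> by (simp add: field_simps)
      finally show ?thesis .
    qed
  qed
  show "\<exists>\<omega>\<in>?M. (\<forall>i\<in>{1..n-1}. \<omega> i \<in> ball xbar lam) \<and> \<omega> n \<in> ball xbar \<eta>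
    \<and> sup0 (?M - {\<omega>})
        (\<lambda>u. ereal ((\<phi> (?g \<omega>) - \<phi> (?g u)) / wnorm n lam \<eta> (\<lambda>i. u i - \<omega> i))) < ereal \<epsilon>
    \<and> 0 < ?g \<omega> \<and> ?g \<omega> \<le> ?m
    \<and> limsup0 \<omega> ?M
        (\<lambda>u. ereal ((\<phi> (?g \<omega>) - \<phi> (?g u)) / wnorm n lam \<eta> (\<lambda>i. u i - \<omega> i))) < ereal \<epsilon>
    \<and> (\<phi> differentiable at (?g \<omega>) \<longrightarrow>
        ereal (deriv \<phi> (?g \<omega>)) * limsup0 \<omega> ?M
          (\<lambda>u. ereal ((?g \<omega> - ?g u) / wnorm n lam \<eta> (\<lambda>i. u i - \<omega> i))) < ereal \<epsilon>)"
    by (intro bexI[OF _ \<omega>] conjI impI balls sup g_pos g_le limsup diff)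
qed

end
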